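(* Let $\Gamma_{2,2,2}=\{1324,1423,123\}$. Then $\mathrm{NM}_{\Gamma_{2,2,2}}(t,x,y)=\left(\frac{1}{U(t,y)}\right)^x$ where $$U(t,y)=1+\sum_{k\ge1}\frac{t^{2k}}{(2k)!}\sum_{i=0}^{k}(2k-1)\downarrow\downarrow_{k-i}(-y)^{k+i}+\sum_{k\ge0}\frac{t^{2k+1}}{(2k+1)!}\sum_{i=0}^{k}(2k)\downarrow\downarrow_{k-i}(-y)^{k+1+i}.$$ Equivalently, the coefficients $U_n(y)=n![t^n]U(t,y)$ satisfy $U_{2k}(-y)=\sum_{i=0}^k(2k-1)\downarrow\downarrow_{k-i}\,y^{k+i}$ and $U_{2k+1}(-y)=\sum_{i=0}^k(2k)\downarrow\downarrow_{k-i}\,y^{k+1+i}$.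
   Context: For any $x$, $(x)\downarrow\downarrow_0=1$ and $(x)\downarrow\downarrow_j=x(x-2)(x-4)\cdots(x-2j+2)$ (a product of $j$ factors) for $j\ge1$. For $\sigma\in\mathfrak S_n$, $\mathrm{des}(\sigma)$ is the number of $i$ with $\sigma_i>\sigma_{i+1}$; $\sigma_j$ is a left-to-right minimum if $\sigma_j<\sigma_i$ for all $i<j$, and $\mathrm{LRmin}(\sigma)$ is their number. For distinct integers $\alpha=\alpha_1\cdots\alpha_r$, $\mathrm{red}(\alpha)\in\mathfrak S_r$ replaces the $i$-th smallest entry by $i$. For a set $\Gamma$ of permutations, $\sigma$ has a $\Gamma$-match starting at position $i$ if there is $j\ge1$ with $\mathrm{red}(\sigma_i\cdots\sigma_{i+j})\in\Gamma$; $\mathcal{NM}_n(\Gamma)$ is the set of $\sigma\in\mathfrak S_n$ with no $\Gamma$-match. $\mathrm{NM}_\Gamma(t,x,y)=1+\sum_{n\ge1}\frac{t^n}{n!}\sum_{\sigma\in\mathcal{NM}_n(\Gamma)}x^{\mathrm{LRmin}(\sigma)}y^{1+\mathrm{des}(\sigma)}$. *)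

theory Defs
  imports
    "HOL-Computational_Algebra.Formal_Power_Series"
    "HOL-Combinatorics.Multiset_Permutations"
begin

text \<open>
  A permutation of \<open>{1..n}\<close> is its one-line word, an element of
  \<^term>\<open>permutations_of_set {1..n::nat}\<close>; list positions are counted from 0.
\<close>

definition des :: "nat list \<Rightarrow> nat" where
  "des \<sigma> = card {i. Suc i < length \<sigma> \<and> \<sigma> ! i > \<sigma> ! Suc i}"

definition LRmin :: "nat list \<Rightarrow> nat" where
  "LRmin \<sigma> = card {j. j < length \<sigma> \<and> (\<forall>i<j. \<sigma> ! j < \<sigma> ! i)}"

text \<open>On a word with distinct entries, the \<open>i\<close>-th smallest entry is the one with
  exactly \<open>i\<close> entries below or equal to it.\<close>

definition red :: "nat list \<Rightarrow> nat list" where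
  "red \<alpha> = map (\<lambda>a. card {b \<in> set \<alpha>. b \<le> a}) \<alpha>"

definition match_at :: "nat list set \<Rightarrow> nat list \<Rightarrow> nat \<Rightarrow> bool" where
  "match_at \<Gamma> \<sigma> i \<longleftrightarrow>
     (\<exists>j\<ge>1. i + j < length \<sigma> \<and> red (take (j + 1) (drop i \<sigma>)) \<in> \<Gamma>)"

definition NM :: "nat list set \<Rightarrow> nat \<Rightarrow> nat list set" where
  "NM \<Gamma> n = {\<sigma> \<in> permutations_of_set {1..n}. \<not> (\<exists>i. match_at \<Gamma> \<sigma> i)}"

text \<open>The generating functions are formal power series in \<open>t\<close>.\<close>

definition NM_gf :: "nat list set \<Rightarrow> 'a \<Rightarrow> 'a \<Rightarrow> 'a :: field_char_0 fps" where
  "NM_gf \<Gamma> x y =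
     1 + Abs_fps (\<lambda>n. if n \<ge> 1
                      then (\<Sum>\<sigma>\<in>NM \<Gamma> n. x ^ LRmin \<sigma> * y ^ (1 + des \<sigma>)) / fact n
                      else 0)"

definition dfall :: "'a \<Rightarrow> nat \<Rightarrow> 'a :: comm_ring_1" where
  "dfall x j = (\<Prod>i<j. x - 2 * of_nat i)"

text \<open>
  The power \<open>F\<^sup>a\<close> with arbitrary exponent, for \<open>F\<close> with constant term 1: the binomial series
  \<open>(1 + X)\<^sup>a\<close> evaluated at \<open>X = F - 1\<close>.
\<close>

definition fps_gpow :: "'a :: field_char_0 fps \<Rightarrow> 'a \<Rightarrow> 'a fps" where
  "fps_gpow F a = fps_compose (fps_binomial a) (F - 1)"

lemma fps_gpow_of_nat:
  assumes "fps_nth F 0 = 1"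
  shows "fps_gpow F (of_nat n) = F ^ n"
  using assms
  by (simp add: fps_gpow_def fps_binomial_of_nat fps_compose_power [symmetric] fps_compose_add_distrib)

definition \<Gamma>222 :: "nat list set" where
  "\<Gamma>222 = {[1,3,2,4], [1,4,2,3], [1,2,3]}"

definition U222 :: "'a \<Rightarrow> 'a :: field_char_0 fps" where
  "U222 y =
     1
     + Abs_fps (\<lambda>n. if even n \<and> n \<ge> 2
         then (let k = n div 2 in
                 (\<Sum>i=0..k. dfall (2 * of_nat k - 1) (k - i) * (- y) ^ (k + i)) / fact (2 * k))
         else 0)
     + Abs_fps (\<lambda>n. if odd n
         then (let k = n div 2 in
                 (\<Sum>i=0..k. dfall (2 * of_nat k) (k - i) * (- y) ^ (k + 1 + i)) / fact (2 * k + 1))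
         else 0)"

end

theory Submission
  imports Defs
begin

text \<open>
  Every pattern in \<open>\<Gamma>222\<close> begins with its smallest letter, so a word \<open>v m w\<close> with smallest letter
  \<open>m\<close> avoids \<open>\<Gamma>222\<close> iff \<open>v\<close> and \<open>m w\<close> do. Hence \<open>N = NM_gf \<Gamma>222 x y\<close> satisfies \<open>N' = x N B\<close>, where
  \<open>B\<close> is the exponential generating function, by the length of \<open>w\<close>, of the weights \<open>y ^ (1 + des (m w))\<close>
  of the avoiding words \<open>m w\<close>. Splitting \<open>w = v m' u\<close> once more at its smallest letter, the initial \<open>m\<close>
  forces \<open>u\<close> to be empty if \<open>v\<close> has at most one letter and otherwise only interacts with \<open>v\<close>, which
  gives the Riccati equation \<open>B' = y + y\<^sup>2 t + (B - y - y t) B\<close>. On the other hand the double factorial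
  recurrence for the coefficients of \<open>U\<close> says \<open>U' = - y (t U + exp (- y t))\<close>, and therefore \<open>- U' / U\<close>
  solves the same Riccati equation with the same initial value \<open>y\<close>. So \<open>B = - U' / U\<close> and \<open>N = U powr (- x)\<close>.
\<close>

section \<open>Avoidance of \<open>\<Gamma>222\<close> as a recursive predicate on words\<close>

text \<open>On distinct letters, an occurrence of 1324 or 1423 is \<open>a b c d\<close> with \<open>a < c\<close> and
  \<open>c\<close> below both of its neighbours.\<close>

fun head_match :: "nat list \<Rightarrow> bool" where
  "head_match [a, b, c] \<longleftrightarrow> a < b \<and> b < c"
| "head_match (a # b # c # d # w) \<longleftrightarrow> a < b \<and> b < c \<or> a < c \<and> c < b \<and> c < d"
| "head_match _ \<longleftrightarrow> False"

fun avoids :: "nat list \<Rightarrow> bool" where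
  "avoids [] \<longleftrightarrow> True"
| "avoids (a # w) \<longleftrightarrow> \<not> head_match (a # w) \<and> avoids w"

lemma length_red [simp]: "length (red w) = length w"
  by (simp add: red_def)

text \<open>Lets simp evaluate the counts in \<open>red\<close> on an explicit word, peeling off one
  letter at a time.\<close>

lemma Collect_insert_le:
  "{b. (b = a \<or> P b) \<and> b \<le> (c::nat)} = (if a \<le> c then insert a {b. P b \<and> b \<le> c} else {b. P b \<and> b \<le> c})"
  by auto

lemma Collect_eq_le: "{b. b = a \<and> b \<le> (c::nat)} = (if a \<le> c then {a} else {})"
  by auto

lemma red_eq_123_iff:
  assumes "distinct [a, b, c]"
  shows "red [a, b, c] = [1, 2, 3] \<longleftrightarrow> a < b \<and> b < c"
  using assms by (auto simp: red_def Collect_insert_le Collect_eq_le card_insert_if)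

lemma red_eq_1324_1423_iff:
  assumes "distinct [a, b, c, d]"
  shows "red [a, b, c, d] = [1, 3, 2, 4] \<or> red [a, b, c, d] = [1, 4, 2, 3]
    \<longleftrightarrow> a < c \<and> c < b \<and> c < d"
  using assms
  by (cases "a < b"; cases "a < c"; cases "a < d"; cases "b < c"; cases "b < d"; cases "c < d")
     (simp_all add: red_def Collect_insert_le Collect_eq_le card_insert_if)

lemma match_at_Cons_Suc: "match_at G (a # w) (Suc i) \<longleftrightarrow> match_at G w i"
  by (simp add: match_at_def)

text \<open>\<open>red\<close> preserves length, so a pattern can only occur in a window of its own
  length.\<close>

lemma match_at_0_iff:
  "match_at \<Gamma>222 w 0 \<longleftrightarrow>
     (length w \<ge> 3 \<and> red (take 3 w) = [1, 2, 3]) \<or>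
     (length w \<ge> 4 \<and> (red (take 4 w) = [1, 3, 2, 4] \<or> red (take 4 w) = [1, 4, 2, 3]))"
  (is "?L \<longleftrightarrow> ?R")
proof
  assume ?L
  then obtain j where j: "j \<ge> 1" "j < length w" "red (take (j + 1) w) \<in> \<Gamma>222"
    by (auto simp: match_at_def)
  define u where "u = red (take (j + 1) w)"
  have "length u = j + 1"
    using j(2) by (simp add: u_def)
  moreover have "u = [1, 2, 3] \<or> u = [1, 3, 2, 4] \<or> u = [1, 4, 2, 3]"
    using j(3) by (auto simp: \<Gamma>222_def u_def)
  ultimately have "j + 1 = 3 \<and> u = [1, 2, 3] \<or> j + 1 = 4 \<and> (u = [1, 3, 2, 4] \<or> u = [1, 4, 2, 3])"
    by auto
  then show ?R
    using j(2) unfolding u_def by (elim disjE conjE) simp_all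
next
  assume ?R
  then show ?L
  proof (elim disjE conjE)
    assume "length w \<ge> 3" "red (take 3 w) = [1, 2, 3]"
    then show ?L
      unfolding match_at_def by (intro exI[of _ 2]) (simp add: \<Gamma>222_def)
  next
    assume "length w \<ge> 4" "red (take 4 w) = [1, 3, 2, 4]"
    then show ?L
      unfolding match_at_def by (intro exI[of _ 3]) (simp add: \<Gamma>222_def)
  next
    assume "length w \<ge> 4" "red (take 4 w) = [1, 4, 2, 3]"
    then show ?L
      unfolding match_at_def by (intro exI[of _ 3]) (simp add: \<Gamma>222_def)
  qed
qed

lemma match_at_0_eq_head_match:
  assumes "distinct w"
  shows "match_at \<Gamma>222 w 0 \<longleftrightarrow> head_match w"
proof (cases w rule: head_match.cases)
  case (1 a b c)
  then show ?thesis
    using assms red_eq_123_iff[of a b c] by (simp add: match_at_0_iff)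
next
  case (2 a b c d v)
  then show ?thesis
    using assms red_eq_123_iff[of a b c] red_eq_1324_1423_iff[of a b c d]
    by (simp add: match_at_0_iff eval_nat_numeral)
qed (simp_all add: match_at_0_iff)

lemma avoids_iff_no_match:
  assumes "distinct w"
  shows "avoids w \<longleftrightarrow> \<not> (\<exists>i. match_at \<Gamma>222 w i)"
  using assms
proof (induction w)
  case Nil
  then show ?case by (simp add: match_at_def)
next
  case (Cons a w)
  have "(\<exists>i. match_at \<Gamma>222 (a # w) i) \<longleftrightarrow> head_match (a # w) \<or> (\<exists>i. match_at \<Gamma>222 w i)"
    using match_at_0_eq_head_match[OF Cons.prems] match_at_Cons_Suc
    by (metis not0_implies_Suc)
  then show ?case
    using Cons by simp
qed

section \<open>Splitting a word at its smallest letter\<close>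

text \<open>A match starting inside \<open>v\<close> cannot use \<open>m\<close>, since every
  pattern has its smallest letter in front.\<close>

lemma head_match_append_min:
  assumes "\<And>a. a \<in> set v \<union> set w \<Longrightarrow> m < a" "v \<noteq> []"
  shows "head_match (v @ m # w) \<longleftrightarrow> head_match v"
  using assms(2)
proof (cases v rule: head_match.cases)
  \<comment> \<open>Here \<open>m\<close> becomes the fourth letter of the window, where a match of
    length 4 would need \<open>c < m\<close>.\<close>
  case (1 a b c)
  then show ?thesis using assms(1)[of c] by simp
next
  case ("3_2" a)
  then show ?thesis using assms(1)[of a] assms(1)
    by (cases "m # w" rule: head_match.cases) (auto dest: less_asym)
next
  case ("3_3" a b)
  then show ?thesis using assms(1)[of a] assms(1)[of b]
    by (cases w) auto
qed auto

lemma avoids_append_min: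
  assumes "\<And>a. a \<in> set v \<union> set w \<Longrightarrow> m < a"
  shows "avoids (v @ m # w) \<longleftrightarrow> avoids v \<and> avoids (m # w)"
  using assms
proof (induction v)
  case (Cons a v)
  then show ?case
    using head_match_append_min[of "a # v" w m] by auto
qed simp

text \<open>With \<open>v\<close> empty, a first letter of \<open>w\<close> would complete 123 after
  \<open>m m'\<close>; with \<open>v = [a]\<close>, it would complete 1324 or 1423 after
  \<open>m a m'\<close>. For longer \<open>v\<close>, the letter \<open>m'\<close> lies too far
  right to create a match at \<open>m\<close>.\<close>

lemma avoids_min_append_min:
  assumes m: "\<And>a. a \<in> set v \<union> set w \<Longrightarrow> m' < a" and "m < m'"
  shows "avoids (m # v @ m' # w) \<longleftrightarrow>
    (if length v \<le> 1 then w = [] else avoids (m # v) \<and> avoids (m' # w))"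
proof (cases "length v \<le> 1")
  case True
  then consider "v = []" | a where "v = [a]"
    by (cases v) auto
  then show ?thesis
  proof cases
    case 1
    then show ?thesis using assms by (cases w; cases "tl w") auto
  next
    case (2 a)
    then show ?thesis using assms by (cases w; cases "tl w") auto
  qed
next
  case False
  then obtain a b u where v: "v = a # b # u"
    by (cases v; cases "tl v") auto
  \<comment> \<open>The letter \<open>m'\<close> is at best fourth in the window at
    \<open>m\<close>, and a match would then need \<open>b < m'\<close>.\<close>
  have "m' < b"
    using m v by auto
  then have "head_match (m # v @ m' # w) \<longleftrightarrow> head_match (m # v)"
    unfolding v by (cases u) auto
  moreover have "avoids (v @ m' # w) \<longleftrightarrow> avoids v \<and> avoids (m' # w)"
    by (rule avoids_append_min[OF m])
  ultimately show ?thesis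
    using False by (simp only: avoids.simps if_False) blast
qed

lemma des_single [simp]: "des [a] = 0"
  by (simp add: des_def)

lemma des_Cons_Cons: "des (a # b # w) = (if b < a then 1 else 0) + des (b # w)"
proof -
  let ?D = "\<lambda>w. {i. Suc i < length w \<and> w ! i > w ! Suc i}"
  have fin: "finite (?D w)" for w :: "nat list"
    by (rule finite_subset[of _ "{..<length w}"]) auto
  have "?D (a # b # w) = (if b < a then {0} else {}) \<union> Suc ` ?D (b # w)"
    (is "?L = ?R")
  proof (rule set_eqI)
    fix i show "i \<in> ?L \<longleftrightarrow> i \<in> ?R"
      by (cases i) auto
  qed
  moreover have "card ?R = (if b < a then 1 else 0) + card (?D (b # w))"
    using fin[of "b # w"] by (subst card_Un_disjoint) (auto simp: card_image)
  ultimately show ?thesis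
    unfolding des_def by simp
qed

text \<open>The extra 1 is the descent from \<open>last v\<close> to \<open>m\<close>; it makes the
  weights \<open>y ^ (1 + des v)\<close> multiplicative.\<close>

lemma des_append:
  assumes "v \<noteq> []" "m < last v"
  shows "des (v @ m # w) = des v + 1 + des (m # w)"
  using assms
proof (induction v rule: induct_list012)
  case (3 a b v)
  then show ?case
    by (simp add: des_Cons_Cons)
qed (auto simp: des_Cons_Cons)

text \<open>The letter \<open>m\<close> is a new left-to-right minimum and blocks all later ones,
  while those of \<open>v\<close> are unaffected.\<close>

lemma LRmin_append_min:
  assumes "\<And>a. a \<in> set v \<union> set w \<Longrightarrow> m < a"
  shows "LRmin (v @ m # w) = Suc (LRmin v)"
proof -
  let ?M = "\<lambda>w. {j. j < length w \<and> (\<forall>i<j. w ! j < w ! i)}"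
  have "j \<in> ?M (v @ m # w) \<longleftrightarrow> j \<in> insert (length v) (?M v)" for j
  proof (cases j "length v" rule: linorder_cases)
    case less
    then show ?thesis by (auto simp: nth_append)
  next
    case equal
    then show ?thesis using assms by (auto simp: nth_append)
  next
    case greater
    have "m < (v @ m # w) ! j" if "j < length (v @ m # w)"
    proof -
      have "(v @ m # w) ! j = w ! (j - Suc (length v))"
        using greater by (simp add: nth_append nth_Cons')
      moreover have "w ! (j - Suc (length v)) \<in> set w"
        using that greater by (intro nth_mem) auto
      ultimately show ?thesis using assms by auto
    qed
    moreover have "(v @ m # w) ! length v = m" by simp
    ultimately have "j \<notin> ?M (v @ m # w)"
      using greater by (metis (mono_tags, lifting) mem_Collect_eq not_less_iff_gr_or_eq)
    then show ?thesis using greater by auto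
  qed
  then have "?M (v @ m # w) = insert (length v) (?M v)" by blast
  then show ?thesis
    by (simp add: LRmin_def)
qed

section \<open>Sums over permutations and exponential generating functions\<close>

lemma takeWhile_dropWhile_neq_append_Cons:
  assumes "m \<notin> set v"
  shows "takeWhile (\<lambda>a. a \<noteq> m) (v @ m # w) = v" "dropWhile (\<lambda>a. a \<noteq> m) (v @ m # w) = m # w"
  using assms by (induction v) auto

text \<open>\<open>S\<close> is the set of letters standing before \<open>m\<close>. Once it is
  fixed, the words on the two sides of \<open>m\<close> vary independently.\<close>

lemma sum_permutations_of_set_insert:
  assumes "finite A" "m \<notin> A"
  shows "sum f (permutations_of_set (insert m A)) =
    (\<Sum>S\<in>Pow A. \<Sum>v\<in>permutations_of_set S. \<Sum>w\<in>permutations_of_set (A - S). f (v @ m # w))"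
proof -
  have fin: "finite S" if "S \<in> Pow A" for S
    using that assms finite_subset by auto
  let ?I = "SIGMA S:Pow A. permutations_of_set S \<times> permutations_of_set (A - S)"
  have "(\<Sum>(S, v, w)\<in>?I. f (v @ m # w)) = sum f (permutations_of_set (insert m A))"
  proof (rule sum.reindex_bij_witness[where
      i = "\<lambda>u. let v = takeWhile (\<lambda>a. a \<noteq> m) u in (set v, v, tl (dropWhile (\<lambda>a. a \<noteq> m) u))"
      and j = "\<lambda>(S, v, w). v @ m # w"])
    fix p assume "p \<in> ?I"
    then obtain S v w where p: "p = (S, v, w)" "S \<subseteq> A"
      "v \<in> permutations_of_set S" "w \<in> permutations_of_set (A - S)" by auto
    then have vw: "set v = S" "set w = A - S" "distinct v" "distinct w"
      by (auto simp: permutations_of_set_def)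
    have "m \<notin> set v" using vw p assms by auto
    then have "takeWhile (\<lambda>a. a \<noteq> m) (v @ m # w) = v" "dropWhile (\<lambda>a. a \<noteq> m) (v @ m # w) = m # w"
      by (simp_all add: takeWhile_dropWhile_neq_append_Cons)
    then show "(let v = takeWhile (\<lambda>a. a \<noteq> m) (case p of (S, v, w) \<Rightarrow> v @ m # w)
        in (set v, v, tl (dropWhile (\<lambda>a. a \<noteq> m) (case p of (S, v, w) \<Rightarrow> v @ m # w)))) = p"
      using p vw by simp
    show "(case p of (S, v, w) \<Rightarrow> v @ m # w) \<in> permutations_of_set (insert m A)"
      using p vw assms by (auto simp: permutations_of_set_def)
    show "f (case p of (S, v, w) \<Rightarrow> v @ m # w) = (case p of (S, v, w) \<Rightarrow> f (v @ m # w))"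
      by (simp add: p)
  next
    fix u assume "u \<in> permutations_of_set (insert m A)"
    then have u: "set u = insert m A" "distinct u"
      by (auto simp: permutations_of_set_def)
    then obtain v w where vw: "u = v @ m # w" "m \<notin> set v"
      by (metis insertI1 split_list_first)
    show "(case (let v = takeWhile (\<lambda>a. a \<noteq> m) u in (set v, v, tl (dropWhile (\<lambda>a. a \<noteq> m) u))) of
        (S, v, w) \<Rightarrow> v @ m # w) = u"
      by (simp add: vw takeWhile_dropWhile_neq_append_Cons)
    have "set v \<subseteq> A" "set w = A - set v" "distinct v" "distinct w"
      using u vw assms by auto
    then show "(let v = takeWhile (\<lambda>a. a \<noteq> m) u in (set v, v, tl (dropWhile (\<lambda>a. a \<noteq> m) u))) \<in> ?I"
      by (simp add: vw takeWhile_dropWhile_neq_append_Cons permutations_of_set_def)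
  qed
  also have "(\<Sum>(S, v, w)\<in>?I. f (v @ m # w)) =
      (\<Sum>S\<in>Pow A. \<Sum>(v, w)\<in>permutations_of_set S \<times> permutations_of_set (A - S). f (v @ m # w))"
    using assms fin by (subst sum.Sigma) auto
  also have "\<dots> = (\<Sum>S\<in>Pow A. \<Sum>v\<in>permutations_of_set S. \<Sum>w\<in>permutations_of_set (A - S). f (v @ m # w))"
    by (simp add: sum.cartesian_product)
  finally show ?thesis by simp
qed

text \<open>Grouping subsets by size turns a sum over splittings into the binomial convolution of
  \<open>fact_mult_fps_mult_nth\<close>.\<close>

lemma sum_Pow_card:
  fixes f :: "nat \<Rightarrow> 'a :: comm_semiring_1"
  assumes "finite A"
  shows "(\<Sum>S\<in>Pow A. f (card S)) = (\<Sum>k\<le>card A. of_nat (card A choose k) * f k)"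
proof -
  have "(\<Sum>S\<in>Pow A. f (card S)) = (\<Sum>k\<le>card A. \<Sum>S\<in>{S \<in> Pow A. card S = k}. f (card S))"
    using assms by (intro sum.group [symmetric]) (auto simp: card_mono)
  also have "\<dots> = (\<Sum>k\<le>card A. of_nat (card A choose k) * f k)"
  proof (rule sum.cong)
    fix k
    have "(\<Sum>S\<in>{S \<in> Pow A. card S = k}. f (card S)) = of_nat (card {S \<in> Pow A. card S = k}) * f k"
      by simp
    then show "(\<Sum>S\<in>{S \<in> Pow A. card S = k}. f (card S)) = of_nat (card A choose k) * f k"
      using n_subsets[OF assms, of k] by simp
  qed simp
  finally show ?thesis .
qed

lemma fact_mult_fps_mult_nth:
  fixes F G :: "'a :: field_char_0 fps"
  shows "fact n * fps_nth (F * G) n =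
    (\<Sum>k\<le>n. of_nat (n choose k) * ((fact k * fps_nth F k) * (fact (n - k) * fps_nth G (n - k))))"
  by (auto simp: fps_mult_nth atLeast0AtMost sum_distrib_left binomial_fact intro!: sum.cong)

lemma fact_mult_fps_deriv_nth:
  fixes F :: "'a :: field_char_0 fps"
  shows "fact n * fps_nth (fps_deriv F) n = fact (Suc n) * fps_nth F (Suc n)"
  by (simp add: mult_ac)

section \<open>The coefficients of U and its differential equation\<close>

lemma dfall_0 [simp]: "dfall x 0 = 1"
  by (simp add: dfall_def)

lemma dfall_Suc: "dfall x (Suc j) = x * dfall (x - 2) j"
  unfolding dfall_def by (subst prod.lessThan_Suc_shift) (simp add: algebra_simps)

lemma U222_nth_even:
  "fact (2 * k) * fps_nth (U222 y) (2 * k) =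
    (\<Sum>i=0..k. dfall (2 * of_nat k - 1) (k - i) * (- y) ^ (k + i))"
  \<comment> \<open>For \<open>k = 0\<close> the sum is 1 and comes from the constant summand of
    \<open>U222\<close>, whose even part starts in degree 2.\<close>
  by (cases "k = 0") (simp_all add: U222_def Let_def)

lemma U222_nth_odd:
  "fact (2 * k + 1) * fps_nth (U222 y) (2 * k + 1) =
    (\<Sum>i=0..k. dfall (2 * of_nat k) (k - i) * (- y) ^ (k + 1 + i))"
  by (simp add: U222_def Let_def del: fact_Suc)

lemma U222_nth_0 [simp]: "fps_nth (U222 y) 0 = 1"
  by (simp add: U222_def)

lemma U222_nth_1 [simp]: "fps_nth (U222 y) (Suc 0) = - y"
  using U222_nth_odd[of 0 y] by (simp add: dfall_def)

text \<open>The top summand is the pure power of \<open>- y\<close>. In every other summand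
  \<open>dfall_Suc\<close> splits off the factor \<open>n + 1\<close>, and with one factor
  \<open>- y\<close> removed the corresponding summand of the coefficient at \<open>n\<close>
  remains.\<close>

lemma U222_nth_rec:
  fixes y :: "'a :: field_char_0"
  shows "fact (n + 2) * fps_nth (U222 y) (n + 2) =
    (- y) ^ (n + 2) - of_nat (n + 1) * y * (fact n * fps_nth (U222 y) n)"
proof (cases "even n")
  case True
  then obtain k where k: "n = 2 * k" by (rule evenE)
  then have n2: "n + 2 = Suc k + Suc k" by simp
  have "fact (n + 2) * fps_nth (U222 y) (n + 2) =
      (\<Sum>i=0..Suc k. dfall (2 * of_nat (Suc k) - 1) (Suc k - i) * (- y) ^ (Suc k + i))"
    using U222_nth_even[of "Suc k" y] by (simp add: k del: fact_Suc)
  also have "\<dots> = (\<Sum>i=0..k. dfall (2 * of_nat (Suc k) - 1) (Suc k - i) * (- y) ^ (Suc k + i))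
      + (- y) ^ (n + 2)"
    unfolding n2 by (simp only: sum.atLeast0_atMost_Suc diff_self_eq_0 dfall_0 mult_1_left)
  also have "(\<Sum>i=0..k. dfall (2 * of_nat (Suc k) - 1) (Suc k - i) * (- y) ^ (Suc k + i)) =
      (\<Sum>i=0..k. - (of_nat (n + 1) * y) * (dfall (2 * of_nat k - 1) (k - i) * (- y) ^ (k + i)))"
    by (intro sum.cong) (simp_all add: Suc_diff_le dfall_Suc k algebra_simps)
  also have "\<dots> = - (of_nat (n + 1) * y) * (fact n * fps_nth (U222 y) n)"
    using U222_nth_even[of k y] by (simp only: sum_distrib_left k)
  finally show ?thesis
    by (simp only: mult_minus_left uminus_add_conv_diff)
next
  case False
  then obtain k where k: "n = 2 * k + 1" by (rule oddE)
  then have n2: "n + 2 = Suc k + 1 + Suc k" by simp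
  have "fact (n + 2) * fps_nth (U222 y) (n + 2) =
      (\<Sum>i=0..Suc k. dfall (2 * of_nat (Suc k)) (Suc k - i) * (- y) ^ (Suc k + 1 + i))"
    using U222_nth_odd[of "Suc k" y] by (simp add: k del: fact_Suc)
  also have "\<dots> = (\<Sum>i=0..k. dfall (2 * of_nat (Suc k)) (Suc k - i) * (- y) ^ (Suc k + 1 + i))
      + (- y) ^ (n + 2)"
    unfolding n2 by (simp only: sum.atLeast0_atMost_Suc diff_self_eq_0 dfall_0 mult_1_left)
  also have "(\<Sum>i=0..k. dfall (2 * of_nat (Suc k)) (Suc k - i) * (- y) ^ (Suc k + 1 + i)) =
      (\<Sum>i=0..k. - (of_nat (n + 1) * y) * (dfall (2 * of_nat k) (k - i) * (- y) ^ (k + 1 + i)))"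
    by (intro sum.cong) (simp_all add: Suc_diff_le dfall_Suc k algebra_simps)
  also have "\<dots> = - (of_nat (n + 1) * y) * (fact n * fps_nth (U222 y) n)"
    using U222_nth_odd[of k y] by (simp only: sum_distrib_left k)
  finally show ?thesis
    by (simp only: mult_minus_left uminus_add_conv_diff)
qed

lemma fps_deriv_U222:
  fixes y :: "'a :: field_char_0"
  shows "fps_deriv (U222 y) = - fps_const y * (fps_X * U222 y + fps_exp (- y))"
proof (rule fps_ext)
  fix n
  show "fps_nth (fps_deriv (U222 y)) n = fps_nth (- fps_const y * (fps_X * U222 y + fps_exp (- y))) n"
  proof (cases n)
    \<comment> \<open>The recurrence starts with the second coefficient of U, so the constant term
      of U' is checked from \<open>U222_nth_1\<close>.\<close>
    case 0
    then show ?thesis by simp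
  next
    case (Suc n')
    have "fact n * fps_nth (fps_deriv (U222 y)) n =
        (- y) ^ (n' + 2) - of_nat (n' + 1) * y * (fact n' * fps_nth (U222 y) n')"
      using U222_nth_rec[of n' y] fact_mult_fps_deriv_nth[of n "U222 y"]
      by (simp add: Suc del: fact_Suc)
    also have "\<dots> = - y * (fact n * fps_nth (U222 y) n' + (- y) ^ n)"
      by (simp add: Suc algebra_simps)
    also have "\<dots> = fact n * fps_nth (- fps_const y * (fps_X * U222 y + fps_exp (- y))) n"
      by (simp add: Suc algebra_simps del: fact_Suc)
    finally show ?thesis
      by (simp only: mult_cancel_left fact_nonzero simp_thms)
  qed
qed

section \<open>The series B and its Riccati equation\<close>

text \<open>Shown in \<open>sum_des_weight\<close> to be the series \<open>B\<close> counting avoiding words that start with their minimum.\<close>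

definition B222 :: "'a \<Rightarrow> 'a :: field_char_0 fps" where
  "B222 y = - fps_deriv (U222 y) * inverse (U222 y)"

lemma U222_mult_inverse: "U222 y * inverse (U222 y) = 1"
  by (rule inverse_mult_eq_1') simp

lemma B222_mult_U222: "B222 y * U222 y = - fps_deriv (U222 y)"
  by (simp add: B222_def mult.assoc inverse_mult_eq_1)

text \<open>Differentiate B U = - U'. The first-order equation for U eliminates the exponential from
  U'', and U' = - B U then makes every term a multiple of U, which cancels.\<close>

lemma fps_deriv_B222:
  fixes y :: "'a :: field_char_0"
  shows "fps_deriv (B222 y) = fps_const y + fps_const (y ^ 2) * fps_X
    + (B222 y - fps_const y - fps_const y * fps_X) * B222 y"
proof -
  let ?U = "U222 y" and ?B = "B222 y" and ?y = "fps_const y" and ?E = "fps_exp (- y)"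
  have U1: "fps_deriv ?U = - (?y * (fps_X * ?U + ?E))"
    using fps_deriv_U222[of y] by (simp only: mult_minus_left)
  have E: "?y * ?E = - fps_deriv ?U - ?y * (fps_X * ?U)"
    unfolding U1 by (simp add: algebra_simps del: fps_const_neg)
  have BU: "fps_deriv ?U = - (?B * ?U)"
    unfolding B222_mult_U222 by simp
  have "fps_deriv (fps_deriv ?U) = - ?y * (?U + fps_X * fps_deriv ?U - ?y * ?E)"
    by (subst U1)
      (simp add: algebra_simps fps_const_neg [symmetric] del: fps_const_mult fps_const_neg)
  then have U2: "fps_deriv (fps_deriv ?U) =
      - ?y * (?U + fps_X * fps_deriv ?U - (- fps_deriv ?U - ?y * (fps_X * ?U)))"
    unfolding E .
  have "fps_deriv ?B * ?U = - fps_deriv (fps_deriv ?U) - ?B * fps_deriv ?U"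
    using arg_cong[OF B222_mult_U222[of y], of fps_deriv] by (simp add: algebra_simps)
  then have "fps_deriv ?B * ?U = (?y + ?y ^ 2 * fps_X + (?B - ?y - ?y * fps_X) * ?B) * ?U"
    unfolding U2 unfolding BU
    by (simp add: algebra_simps power2_eq_square del: fps_const_mult fps_const_neg)
  moreover have "?U \<noteq> 0"
    using U222_nth_0[of y] by (metis fps_zero_nth zero_neq_one)
  ultimately show ?thesis
    by (simp add: fps_const_power)
qed

lemma B222_nth_0 [simp]: "fps_nth (B222 y) 0 = y"
  by (simp add: B222_def)

text \<open>With \<open>B222_nth_0\<close>, this shows that B - y - y t is B with its terms of
  degree 0 and 1 removed.\<close>

lemma B222_nth_1 [simp]: "fps_nth (B222 y) (Suc 0) = y"
  using arg_cong[OF fps_deriv_B222[of y], of "\<lambda>F. fps_nth F 0"] by simp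

text \<open>The Riccati equation in the shape of the combinatorial splitting: \<open>k\<close> is
  the number of letters before the second minimum, and \<open>k \<le> 1\<close> forces nothing to
  follow it, that is \<open>k = n\<close>.\<close>

lemma B222_nth_Suc:
  fixes y :: "'a :: field_char_0"
  defines "b \<equiv> \<lambda>k. fact k * fps_nth (B222 y) k"
  shows "b (Suc n) = (\<Sum>k\<le>n. of_nat (n choose k) *
    (if k \<le> 1 then if k = n then y ^ Suc k else 0 else b k * b (n - k)))"
proof -
  let ?C = "B222 y - fps_const y - fps_const y * fps_X"
  have C: "fact k * fps_nth ?C k = (if k \<le> 1 then 0 else b k)" for k
    by (cases k rule: nat.exhaust; cases "k - 1") (auto simp: b_def)
  have "b (Suc n) = fact n * fps_nth (fps_const y + fps_const (y ^ 2) * fps_X) n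
      + fact n * fps_nth (?C * B222 y) n"
    unfolding b_def fact_mult_fps_deriv_nth[symmetric] fps_deriv_B222 by (simp add: algebra_simps)
  \<comment> \<open>The coefficients y and y^2 account for the cases \<open>k = n = 0\<close> and
    \<open>k = n = 1\<close>; the binomial coefficient is 1 there.\<close>
  also have "fact n * fps_nth (fps_const y + fps_const (y ^ 2) * fps_X) n =
      (\<Sum>k\<le>n. if k = n then if n \<le> 1 then y ^ Suc n else 0 else 0)"
    by (cases n rule: nat.exhaust; cases "n - 1") (auto simp: power2_eq_square)
  also have "fact n * fps_nth (?C * B222 y) n =
      (\<Sum>k\<le>n. of_nat (n choose k) * ((if k \<le> 1 then 0 else b k) * b (n - k)))"
    unfolding fact_mult_fps_mult_nth C by (simp add: b_def)
  finally have "b (Suc n) = (\<Sum>k\<le>n. (if k = n then if n \<le> 1 then y ^ Suc n else 0 else 0) +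
      of_nat (n choose k) * ((if k \<le> 1 then 0 else b k) * b (n - k)))"
    by (simp only: sum.distrib)
  also have "\<dots> = (\<Sum>k\<le>n. of_nat (n choose k) *
      (if k \<le> 1 then if k = n then y ^ Suc k else 0 else b k * b (n - k)))"
    by (intro sum.cong) auto
  finally show ?thesis .
qed

section \<open>Powers with arbitrary exponent\<close>

lemma fps_gpow_nth_0: "fps_nth (fps_gpow F a) 0 = 1"
  by (simp add: fps_gpow_def)

text \<open>The binomial series b satisfies (1 + X) b' = a b; substituting F - 1 for X turns 1 + X
  into F, and the chain rule supplies F'.\<close>

lemma fps_deriv_gpow:
  fixes F :: "'a :: field_char_0 fps"
  assumes "fps_nth F 0 = 1"
  shows "F * fps_deriv (fps_gpow F a) = fps_const a * fps_gpow F a * fps_deriv F"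
proof -
  let ?b = "fps_binomial a"
  have F0: "fps_nth (F - 1) 0 = 0"
    using assms by simp
  have "(1 + fps_X) * fps_deriv ?b = fps_const a * ?b"
    by (simp add: fps_binomial_deriv fps_divide_unit mult_ac inverse_mult_eq_1')
  then have "((1 + fps_X) * fps_deriv ?b) oo (F - 1) = (fps_const a * ?b) oo (F - 1)"
    by simp
  then have "F * (fps_deriv ?b oo (F - 1)) = fps_const a * fps_gpow F a"
    using F0 by (simp add: fps_compose_mult_distrib fps_compose_add_distrib fps_gpow_def)
  then show ?thesis
    using F0 by (simp add: fps_gpow_def fps_compose_deriv mult.assoc [symmetric])
qed

text \<open>The logarithmic derivative of 1 / U is - U' / U = B.\<close>

lemma fps_deriv_gpow_U222:
  "fps_deriv (fps_gpow (1 / U222 y) x) = fps_const x * (fps_gpow (1 / U222 y) x * B222 y)"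
proof -
  let ?U = "U222 y" and ?N = "1 / U222 y" and ?G = "fps_gpow (1 / U222 y) x"
  have N: "?N = inverse ?U"
    by (simp add: fps_divide_unit)
  have UN: "?U * ?N = 1"
    by (simp add: N U222_mult_inverse)
  have "fps_deriv ?U * ?N + ?U * fps_deriv ?N = 0"
    using arg_cong[OF UN, of fps_deriv] unfolding fps_deriv_mult by (simp add: add.commute)
  then have N': "?U * fps_deriv ?N = B222 y"
    by (simp add: B222_def N eq_neg_iff_add_eq_0 add.commute del: fps_const_neg)
  have "?U * (?N * fps_deriv ?G) = ?U * (fps_const x * ?G * fps_deriv ?N)"
    by (subst fps_deriv_gpow) (simp_all add: N)
  then have "(?U * ?N) * fps_deriv ?G = fps_const x * (?G * (?U * fps_deriv ?N))"
    by (simp only: mult_ac)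
  then show ?thesis
    unfolding UN N' by simp
qed

section \<open>Weighted counts of avoiding words\<close>

text \<open>Vanishes on words with a match, so that sums can run over all permutations of a
  set.\<close>

definition des_weight :: "'a \<Rightarrow> nat list \<Rightarrow> 'a :: field_char_0" where
  "des_weight y v = (if avoids v then y ^ (1 + des v) else 0)"

text \<open>The empty word gets weight 1 instead of \<open>y\<close>, to agree with the constant
  term of \<open>NM_gf\<close>.\<close>

definition perm_weight :: "'a \<Rightarrow> 'a \<Rightarrow> nat list \<Rightarrow> 'a :: field_char_0" where
  "perm_weight x y v = (if v = [] then 1 else x ^ LRmin v * des_weight y v)"

lemma des_weight_append_min:
  assumes "\<And>a. a \<in> set v \<union> set w \<Longrightarrow> m' < a" "m < m'"
  shows "des_weight y (m # v @ m' # w) =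
    (if length v \<le> 1 then if w = [] then y ^ Suc (length v) else 0
     else des_weight y (m # v) * des_weight y (m' # w))"
proof (cases "length v \<le> 1")
  case True
  then consider "v = []" | a where "v = [a]"
    by (cases v) auto
  \<comment> \<open>There is no descent in \<open>m m'\<close>, and exactly one in
    \<open>m a m'\<close> because \<open>m < a\<close> and \<open>m' < a\<close>.\<close>
  then have "des (m # v @ [m']) = length v"
  proof cases
    case 2
    then show ?thesis using assms(1)[of a] assms(2) by (simp add: des_Cons_Cons)
  qed (use assms in \<open>simp add: des_Cons_Cons\<close>)
  then show ?thesis
    using True avoids_min_append_min[of v w m' m] assms
    by (simp add: des_weight_def del: avoids.simps)
next
  case False
  then have "v \<noteq> []" by auto
  then have "des (m # v @ m' # w) = des (m # v) + 1 + des (m' # w)"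
    using des_append[of "m # v" m' w] assms(1)[of "last v"] by simp
  then show ?thesis
    using False avoids_min_append_min[of v w m' m] assms
    by (simp add: des_weight_def power_add del: avoids.simps)
qed

text \<open>The factor \<open>x\<close> records \<open>m\<close> as a left-to-right minimum. If
  \<open>v\<close> is empty, no descent leads into \<open>m\<close>, which the weight 1 of the empty
  word compensates.\<close>

lemma perm_weight_append_min:
  assumes "\<And>a. a \<in> set v \<union> set w \<Longrightarrow> m < a"
  shows "perm_weight x y (v @ m # w) = perm_weight x y v * (x * des_weight y (m # w))"
proof (cases "v = []")
  case True
  then show ?thesis
    using LRmin_append_min[of v w m] assms by (simp add: perm_weight_def LRmin_def)
next
  case False
  then have "des (v @ m # w) = des v + 1 + des (m # w)"
    using assms by (intro des_append) auto
  then show ?thesis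
    using False LRmin_append_min[of v w m] avoids_append_min[of v w m] assms
    by (simp add: perm_weight_def des_weight_def power_add del: avoids.simps)
qed

text \<open>Splitting at the smallest letter of \<open>T\<close> reproduces the recurrence
  \<open>B222_nth_Suc\<close>. The induction leaves \<open>m\<close> arbitrary because the
  right-hand factor is headed by \<open>m'\<close>.\<close>

lemma sum_des_weight:
  fixes y :: "'a :: field_char_0"
  assumes "finite T" "\<And>a. a \<in> T \<Longrightarrow> m < a"
  shows "(\<Sum>v\<in>permutations_of_set T. des_weight y (m # v)) = fact (card T) * fps_nth (B222 y) (card T)"
  using assms
proof (induction "card T" arbitrary: T m rule: less_induct)
  case less
  define b where "b = (\<lambda>k. fact k * fps_nth (B222 y) k)"
  show ?case
  proof (cases "T = {}")
    case True
    then show ?thesis by (simp add: des_weight_def)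
  next
    case False
    define m' A where "m' = Min T" and "A = T - {m'}"
    have m': "m' \<in> T" "\<And>a. a \<in> A \<Longrightarrow> m' < a"
      using less.prems(1) False by (auto simp: m'_def A_def order_less_le)
    then have mm': "m < m'" using less.prems(2) by auto
    have T: "T = insert m' A" "m' \<notin> A" "finite A" "card T = Suc (card A)"
      using m'(1) less.prems(1) card_Suc_Diff1[of T m'] by (auto simp: A_def)
    have "(\<Sum>v\<in>permutations_of_set S. \<Sum>w\<in>permutations_of_set (A - S). des_weight y (m # v @ m' # w)) =
        (if card S \<le> 1 then if card S = card A then y ^ Suc (card S) else 0
         else b (card S) * b (card A - card S))" (is "?L = _")
      if S: "S \<in> Pow A" for S
    proof -
      have fin: "finite S" "finite (A - S)" using S T(3) finite_subset by auto
      have "?L = (\<Sum>v\<in>permutations_of_set S. \<Sum>w\<in>permutations_of_set (A - S).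
          if card S \<le> 1 then if w = [] then y ^ Suc (card S) else 0
          else des_weight y (m # v) * des_weight y (m' # w))"
      proof (intro sum.cong refl)
        fix v w assume vw: "v \<in> permutations_of_set S" "w \<in> permutations_of_set (A - S)"
        then have "m' < a" if "a \<in> set v \<union> set w" for a
          using that m'(2) S by (auto simp: permutations_of_set_def)
        moreover have "length v = card S"
          using vw by (simp add: length_finite_permutations_of_set)
        ultimately show "des_weight y (m # v @ m' # w) =
            (if card S \<le> 1 then if w = [] then y ^ Suc (card S) else 0
             else des_weight y (m # v) * des_weight y (m' # w))"
          using des_weight_append_min[of v w m' m y] mm' by simp
      qed
      also have "\<dots> = (if card S \<le> 1 then if card S = card A then y ^ Suc (card S) else 0
         else b (card S) * b (card A - card S))"
      proof (cases "card S \<le> 1")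
        case True
        \<comment> \<open>Only the empty right-hand word contributes, so all of \<open>A\<close>
          must lie before \<open>m'\<close>; a set of at most one letter then has a single
          arrangement.\<close>
        have "[] \<in> permutations_of_set (A - S) \<longleftrightarrow> card S = card A"
          using S T(3) card_subset_eq[of A S] by (auto simp: permutations_of_set_def)
        moreover have "fact (card S) = (1 :: 'a)"
          using True by (cases "card S") auto
        ultimately show ?thesis
          using True fin by simp
      next
        case False
        have "card S < card T" "card (A - S) < card T"
          using S T card_mono[of A S] card_mono[of A "A - S"] by auto
        then have "(\<Sum>v\<in>permutations_of_set S. des_weight y (m # v)) = b (card S)"
            "(\<Sum>w\<in>permutations_of_set (A - S). des_weight y (m' # w)) = b (card (A - S))"
          unfolding b_def using S T fin m'(2) less.prems(2) by (intro less.hyps; auto)+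
        moreover have "card (A - S) = card A - card S"
          using S fin by (simp add: card_Diff_subset)
        ultimately show ?thesis
          using False by (simp add: sum_product [symmetric])
      qed
      finally show ?thesis .
    qed
    then have "(\<Sum>v\<in>permutations_of_set T. des_weight y (m # v)) =
        (\<Sum>S\<in>Pow A. if card S \<le> 1 then if card S = card A then y ^ Suc (card S) else 0
         else b (card S) * b (card A - card S))"
      unfolding T(1) sum_permutations_of_set_insert[OF T(3,2)] by (rule sum.cong[OF refl])
    also have "\<dots> = b (Suc (card A))"
      unfolding b_def B222_nth_Suc by (rule sum_Pow_card[OF T(3)])
    finally show ?thesis
      by (simp only: b_def T(4))
  qed
qed

text \<open>Splitting at the minimum leaves a shorter word of the same kind on the left and a word
  counted by B on the right; the resulting recurrence is G' = x G B for the power series G.\<close>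

lemma sum_perm_weight:
  fixes x y :: "'a :: field_char_0"
  assumes "finite T"
  shows "(\<Sum>v\<in>permutations_of_set T. perm_weight x y v) =
    fact (card T) * fps_nth (fps_gpow (1 / U222 y) x) (card T)"
  using assms
proof (induction "card T" arbitrary: T rule: less_induct)
  case less
  define b where "b = (\<lambda>k. fact k * fps_nth (B222 y) k)"
  define g where "g = (\<lambda>k. fact k * fps_nth (fps_gpow (1 / U222 y) x) k)"
  show ?case
  proof (cases "T = {}")
    case True
    then show ?thesis by (simp add: perm_weight_def fps_gpow_nth_0)
  next
    case False
    define m A where "m = Min T" and "A = T - {m}"
    have m: "m \<in> T" "\<And>a. a \<in> A \<Longrightarrow> m < a"
      using less.prems False by (auto simp: m_def A_def order_less_le)
    have T: "T = insert m A" "m \<notin> A" "finite A" "card T = Suc (card A)"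
      using m(1) less.prems card_Suc_Diff1[of T m] by (auto simp: A_def)
    have "(\<Sum>v\<in>permutations_of_set S. \<Sum>w\<in>permutations_of_set (A - S). perm_weight x y (v @ m # w)) =
        x * (g (card S) * b (card A - card S))" (is "?L = _")
      if S: "S \<in> Pow A" for S
    proof -
      have fin: "finite S" "finite (A - S)" using S T(3) finite_subset by auto
      have "?L = (\<Sum>v\<in>permutations_of_set S. \<Sum>w\<in>permutations_of_set (A - S).
          perm_weight x y v * (x * des_weight y (m # w)))"
        using m(2) S
        by (intro sum.cong refl perm_weight_append_min) (auto simp: permutations_of_set_def)
      also have "\<dots> = (\<Sum>v\<in>permutations_of_set S. perm_weight x y v) *
          (x * (\<Sum>w\<in>permutations_of_set (A - S). des_weight y (m # w)))"
        by (subst sum_distrib_left) (simp only: sum_product)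
      also have "(\<Sum>v\<in>permutations_of_set S. perm_weight x y v) = g (card S)"
        unfolding g_def using S T fin card_mono[of A S] by (intro less.hyps) auto
      also have "(\<Sum>w\<in>permutations_of_set (A - S). des_weight y (m # w)) = b (card (A - S))"
        unfolding b_def using fin m(2) by (intro sum_des_weight) auto
      also have "card (A - S) = card A - card S"
        using S fin by (simp add: card_Diff_subset)
      finally show ?thesis by (simp add: mult_ac)
    qed
    then have "(\<Sum>v\<in>permutations_of_set T. perm_weight x y v) =
        (\<Sum>S\<in>Pow A. x * (g (card S) * b (card A - card S)))"
      unfolding T(1) sum_permutations_of_set_insert[OF T(3,2)] by (rule sum.cong[OF refl])
    also have "\<dots> = x * (\<Sum>S\<in>Pow A. g (card S) * b (card A - card S))"
      by (simp only: sum_distrib_left)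
    also have "(\<Sum>S\<in>Pow A. g (card S) * b (card A - card S)) =
        fact (card A) * fps_nth (fps_gpow (1 / U222 y) x * B222 y) (card A)"
      unfolding fact_mult_fps_mult_nth b_def g_def by (rule sum_Pow_card[OF T(3)])
    also have "x * \<dots> = fact (card A) * fps_nth (fps_deriv (fps_gpow (1 / U222 y) x)) (card A)"
      unfolding fps_deriv_gpow_U222 by simp
    finally show ?thesis
      unfolding fact_mult_fps_deriv_nth T(4) .
  qed
qed

theorem theorem5:
  fixes x y :: "'a :: field_char_0"
  shows "NM_gf \<Gamma>222 x y = fps_gpow (1 / U222 y) x
    \<and> (\<forall>k. fact (2 * k) * fps_nth (U222 (- y)) (2 * k)
            = (\<Sum>i=0..k. dfall (2 * of_nat k - 1) (k - i) * y ^ (k + i)))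
    \<and> (\<forall>k. fact (2 * k + 1) * fps_nth (U222 (- y)) (2 * k + 1)
            = (\<Sum>i=0..k. dfall (2 * of_nat k) (k - i) * y ^ (k + 1 + i)))"
proof (intro conjI allI)
  show "NM_gf \<Gamma>222 x y = fps_gpow (1 / U222 y) x"
  proof (rule fps_ext)
    fix n
    show "fps_nth (NM_gf \<Gamma>222 x y) n = fps_nth (fps_gpow (1 / U222 y) x) n"
    proof (cases "n = 0")
      case True
      then show ?thesis by (simp add: NM_gf_def fps_gpow_nth_0)
    next
      case False
      have "NM \<Gamma>222 n = {v \<in> permutations_of_set {1..n}. avoids v}"
        unfolding NM_def using avoids_iff_no_match by (auto simp: permutations_of_set_def)
      then have "(\<Sum>v\<in>NM \<Gamma>222 n. x ^ LRmin v * y ^ (1 + des v)) =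
          (\<Sum>v\<in>permutations_of_set {1..n}. if avoids v then x ^ LRmin v * y ^ (1 + des v) else 0)"
        by (simp only: sum.inter_filter finite_permutations_of_set)
      \<comment> \<open>As \<open>n\<close> is positive, the special value at the empty word does
        not occur.\<close>
      also have "\<dots> = (\<Sum>v\<in>permutations_of_set {1..n}. perm_weight x y v)"
        using False
        by (intro sum.cong) (auto simp: perm_weight_def des_weight_def permutations_of_set_def)
      finally show ?thesis
        using False sum_perm_weight[of "{1..n}" x y] by (simp add: NM_gf_def)
    qed
  qed
qed (use U222_nth_even[of _ "- y"] U222_nth_odd[of _ "- y"] in simp_all)

end
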